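(* Let $\mu=(\mu_0,\mu_1,\dotsc,\mu_\ell)$ be an integer partition with $\ell\geq1$, $1\leq d\leq\mu_0$, $\mu_\ell=1$ and $\mu_{\ell-1}\geq d$. Then \[ \sum_{n\geq0}S_{\mu,d,n}(s_1,\dotsc,s_d)x^n=\frac{1}{1-x\prod_{r=1}^{d}(1+s_rx^\ell)}. \] In particular, setting $s_1=s$ and $s_2=\cdots=s_d=1$ gives $\dfrac{1}{1-x(1+x^\ell)^{d-1}(1+sx^\ell)}$.
   Context: An anchor word for $\mu$ of length $n$ is a word $a_1\cdots a_n$ over $\{1,\dotsc,d,\infty\}$ such that $a_i\neq\infty$ implies $a_{i+k}\geq a_i+\mu_k$ for $k=1,\dotsc,\ell$ ($\infty$ larger than every integer) and $a_{n-\ell+1}=\cdots=a_n=\infty$. $S_{\mu,d,n}(s_1,\dotsc,s_d)=\sum_w\prod_{i:\,a_i\neq\infty}s_{a_i}$, the sum over all anchor words $w=a_1\cdots a_n$ of length $n$. *)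

theory Defs
  imports "HOL-Computational_Algebra.Formal_Power_Series" "HOL-Library.Extended_Nat"
begin

text \<open>A partition \<open>(\<mu>\<^sub>0, \<dots>, \<mu>\<^sub>\<ell>)\<close> is the list of its parts, so \<open>\<mu>\<^sub>k\<close> is \<open>\<mu> ! k\<close> and
  \<open>\<ell> = length \<mu> - 1\<close>.\<close>

definition integer_partition :: "nat list \<Rightarrow> bool" where
  "integer_partition \<mu> \<longleftrightarrow> sorted_wrt (\<ge>) \<mu> \<and> (\<forall>m\<in>set \<mu>. 1 \<le> m)"

text \<open>Words are lists, so the letter \<open>a\<^sub>i\<close> (\<open>1 \<le> i \<le> n\<close>) is \<open>w ! (i - 1)\<close>. The third conjunct says
  that the last \<open>\<ell>\<close> letters are \<open>\<infinity>\<close> (all letters, if \<open>n < \<ell>\<close>); it guarantees \<open>i + k < n\<close> whenever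
  the list is accessed at \<open>i + k\<close> in the fourth.\<close>

definition anchor_word :: "nat list \<Rightarrow> nat \<Rightarrow> nat \<Rightarrow> enat list \<Rightarrow> bool" where
  "anchor_word \<mu> d n w \<longleftrightarrow>
     (let l = length \<mu> - 1 in
        length w = n \<and>
        set w \<subseteq> enat ` {1..d} \<union> {\<infinity>} \<and>
        (\<forall>i<n. n \<le> i + l \<longrightarrow> w ! i = \<infinity>) \<and>
        (\<forall>i<n. w ! i \<noteq> \<infinity> \<longrightarrow> (\<forall>k\<in>{1..l}. w ! (i + k) \<ge> w ! i + enat (\<mu> ! k))))"

lemma finite_anchor_words: "finite {w. anchor_word \<mu> d n w}"
  by (rule finite_subset[OF _ finite_lists_length_eq[of "enat ` {1..d} \<union> {\<infinity>}" n]])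
     (auto simp: anchor_word_def Let_def)

text \<open>The variables \<open>s\<^sub>1, \<dots>, s\<^sub>d\<close> are elements \<open>s 1, \<dots>, s d\<close> of a commutative ring. As the ring is
  arbitrary, indeterminates over the integers are included.\<close>

definition anchor_sum ::
    "nat list \<Rightarrow> nat \<Rightarrow> nat \<Rightarrow> (nat \<Rightarrow> 'a::comm_ring_1) \<Rightarrow> 'a" where
  "anchor_sum \<mu> d n s =
     (\<Sum>w\<in>{w. anchor_word \<mu> d n w}. \<Prod>i\<in>{i. i < n \<and> w ! i \<noteq> \<infinity>}. s (the_enat (w ! i)))"

text \<open>The division of \<open>'a fps\<close> needs a division on \<open>'a\<close>, which a commutative ring does not have.
  A series with constant term 1 is nevertheless a unit of the power series ring; \<open>fps_recip\<close> is
  its inverse there, and it agrees with \<open>1 / f\<close> over a field.\<close>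

definition fps_recip :: "'a::comm_ring_1 fps \<Rightarrow> 'a fps" where
  "fps_recip f = fps_right_inverse f 1"

lemma fps_recip_right: "fps_nth f 0 = 1 \<Longrightarrow> f * fps_recip f = 1"
  unfolding fps_recip_def by (rule fps_right_inverse) simp

lemma fps_recip_unique:
  assumes "fps_nth f 0 = 1"
  shows "fps_recip f = g \<longleftrightarrow> g * f = 1"
proof
  show "fps_recip f = g \<Longrightarrow> g * f = 1"
    using fps_recip_right[OF assms] by (metis mult.commute)
  assume "g * f = 1"
  then have "g * (f * fps_recip f) = fps_recip f"
    by (metis mult.assoc mult_1)
  then show "fps_recip f = g"
    using fps_recip_right[OF assms] by simp
qed

lemma fps_recip_field:
  fixes f :: "'a::field fps"
  shows "fps_nth f 0 = 1 \<Longrightarrow> fps_recip f = 1 / f"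
  by (simp add: fps_recip_def fps_divide_unit fps_inverse_def)

end

theory Submission
  imports Defs
begin

text \<open>Since \<open>\<mu>\<^sub>k \<ge> d\<close> for \<open>k < \<ell>\<close> and \<open>\<mu>\<^sub>\<ell> = 1\<close>, a finite letter \<open>r\<close> of an anchor word is followed
  by \<open>\<ell> - 1\<close> letters \<open>\<infinity>\<close> and then by a letter larger than \<open>r\<close>. Let \<open>F\<close> be the generating function
  of all anchor words and \<open>G\<^sub>m\<close> that of the nonempty ones whose first letter exceeds \<open>m\<close>. Removing
  the first letter \<open>\<infinity>\<close>, or the first \<open>\<ell>\<close> letters \<open>m \<infinity> \<dots> \<infinity>\<close>, gives \<open>G\<^sub>d = x F\<close> and
  \<open>G\<^bsub>m-1\<^esub> = (1 + s\<^sub>m x\<^sup>\<ell>) G\<^sub>m\<close>. With \<open>F = 1 + G\<^sub>0\<close> this determines \<open>F\<close>.\<close>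

section \<open>Weights of words\<close>

definition letter_weight :: "(nat \<Rightarrow> 'a::comm_ring_1) \<Rightarrow> enat \<Rightarrow> 'a" where
  "letter_weight s a = (if a = \<infinity> then 1 else s (the_enat a))"

definition word_weight :: "(nat \<Rightarrow> 'a::comm_ring_1) \<Rightarrow> enat list \<Rightarrow> 'a" where
  "word_weight s w = prod_list (map (letter_weight s) w)"

lemma word_weight_Nil [simp]: "word_weight s [] = 1"
  and word_weight_Cons [simp]: "word_weight s (a # w) = letter_weight s a * word_weight s w"
  and word_weight_append [simp]: "word_weight s (v @ w) = word_weight s v * word_weight s w"
  by (simp_all add: word_weight_def)

lemma word_weight_replicate_infinity [simp]: "word_weight s (replicate k \<infinity>) = 1"
  by (simp add: word_weight_def letter_weight_def)

text \<open>Since \<infinity> has weight 1, the product may run over all positions; in this form it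
  is multiplicative under concatenation, so initial letters can be split off.\<close>

lemma anchor_sum_eq_sum_word_weight:
  "anchor_sum \<mu> d n s = (\<Sum>w\<in>{w. anchor_word \<mu> d n w}. word_weight s w)"
  unfolding anchor_sum_def
proof (rule sum.cong[OF refl])
  fix w assume "w \<in> {w. anchor_word \<mu> d n w}"
  then have n: "length w = n" by (simp add: anchor_word_def Let_def)
  have "(\<Prod>i\<in>{i. i < n \<and> w ! i \<noteq> \<infinity>}. s (the_enat (w ! i))) = (\<Prod>i<n. letter_weight s (w ! i))"
    by (rule prod.mono_neutral_cong_left) (auto simp: letter_weight_def)
  then show "(\<Prod>i\<in>{i. i < n \<and> w ! i \<noteq> \<infinity>}. s (the_enat (w ! i))) = word_weight s w"
    by (simp add: word_weight_def prod.list_conv_set_nth n atLeast0LessThan)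
qed

section \<open>Removing initial letters of an anchor word\<close>

lemma anchor_word_length: "anchor_word \<mu> d n w \<Longrightarrow> length w = n"
  by (simp add: anchor_word_def Let_def)

lemma anchor_word_0_iff [simp]: "anchor_word \<mu> d 0 w \<longleftrightarrow> w = []"
  by (auto simp: anchor_word_def Let_def)

lemma Collect_anchor_word_0 [simp]: "Collect (anchor_word \<mu> d 0) = {[]}"
  by auto

lemma all_less_Suc_iff: "(\<forall>i<Suc n. P i) \<longleftrightarrow> P 0 \<and> (\<forall>i<n. P (Suc i))"
  by (auto simp: less_Suc_eq_0_disj)

text \<open>The conditions at later positions are those of \<open>w\<close>, shifted by one, so only
  the condition at \<open>a\<close> is new. A finite \<open>a\<close> must lie outside the last
  \<open>l\<close> positions, hence \<open>l \<le> n\<close>.\<close>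

lemma anchor_word_Cons_iff:
  assumes "length \<mu> = l + 1"
  shows "anchor_word \<mu> d (Suc n) (a # w) \<longleftrightarrow> anchor_word \<mu> d n w \<and>
    (a = \<infinity> \<or> l \<le> n \<and> a \<in> enat ` {1..d} \<and> (\<forall>k<l. a + enat (\<mu> ! Suc k) \<le> w ! k))"
proof -
  have "length \<mu> - 1 = l" using assms by simp
  then show ?thesis
    \<comment> \<open>Writing \<open>{1..l}\<close> as the image of \<open>{..<l}\<close> under
      \<open>Suc\<close> turns the letter at distance \<open>Suc k\<close> from \<open>a\<close>
      into \<open>w ! k\<close>.\<close>
    unfolding anchor_word_def Let_def all_less_Suc_iff image_Suc_lessThan[symmetric] by auto
qed

lemma anchor_word_infinity_Cons_iff [simp]:
  "\<mu> \<noteq> [] \<Longrightarrow> anchor_word \<mu> d (Suc n) (\<infinity> # w) \<longleftrightarrow> anchor_word \<mu> d n w"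
  using anchor_word_Cons_iff[of \<mu> "length \<mu> - 1" d n \<infinity> w] by (cases \<mu>) auto

lemma anchor_word_replicate_infinity_append_iff [simp]:
  "\<mu> \<noteq> [] \<Longrightarrow> anchor_word \<mu> d (k + n) (replicate k \<infinity> @ w) \<longleftrightarrow> anchor_word \<mu> d n w"
  by (induction k) auto

section \<open>Generating functions by first letter\<close>

definition words_above :: "nat list \<Rightarrow> nat \<Rightarrow> nat \<Rightarrow> nat \<Rightarrow> enat list set" where
  "words_above \<mu> d m n = {w. anchor_word \<mu> d n w \<and> w \<noteq> [] \<and> enat m < hd w}"

definition words_above_series ::
    "nat list \<Rightarrow> nat \<Rightarrow> (nat \<Rightarrow> 'a::comm_ring_1) \<Rightarrow> nat \<Rightarrow> 'a fps" where
  "words_above_series \<mu> d s m = Abs_fps (\<lambda>n. \<Sum>w\<in>words_above \<mu> d m n. word_weight s w)"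

lemma finite_words_above: "finite (words_above \<mu> d m n)"
  by (rule finite_subset[OF _ finite_anchor_words[of \<mu> d n]]) (auto simp: words_above_def)

lemma anchor_word_hd_cases:
  assumes "anchor_word \<mu> d n w" "w \<noteq> []"
  obtains "hd w = \<infinity>" | r where "r \<in> {1..d}" "hd w = enat r"
proof -
  have "hd w \<in> enat ` {1..d} \<union> {\<infinity>}"
    using hd_in_set[OF assms(2)] assms(1) unfolding anchor_word_def Let_def by blast
  then show ?thesis using that by blast
qed

text \<open>Finite letters are at least 1, so every nonempty word starts above 0. The empty word,
  kept out of \<open>words_above\<close> because \<open>hd []\<close> is unspecified, gives the
  summand 1.\<close>

lemma anchor_series_eq:
  "Abs_fps (\<lambda>n. anchor_sum \<mu> d n s) = 1 + words_above_series \<mu> d s 0"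
proof (rule fps_ext)
  fix n
  have "words_above \<mu> d 0 n = {w. anchor_word \<mu> d n w}" if "n > 0"
  proof -
    have "w \<noteq> [] \<and> enat 0 < hd w" if w: "anchor_word \<mu> d n w" for w
    proof
      show "w \<noteq> []" using anchor_word_length[OF w] \<open>n > 0\<close> by auto
      with w show "enat 0 < hd w" by (cases rule: anchor_word_hd_cases) auto
    qed
    then show ?thesis by (auto simp: words_above_def)
  qed
  moreover have "words_above \<mu> d 0 0 = {}"
    by (auto simp: words_above_def)
  ultimately show "fps_nth (Abs_fps (\<lambda>n. anchor_sum \<mu> d n s)) n =
      fps_nth (1 + words_above_series \<mu> d s 0) n"
    by (cases "n = 0") (simp_all add: words_above_series_def anchor_sum_eq_sum_word_weight)
qed

text \<open>Only \<infinity> exceeds \<open>d\<close>, and it can be put in front of any anchor word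
  without changing the weight.\<close>

lemma words_above_series_top:
  assumes "\<mu> \<noteq> []"
  shows "words_above_series \<mu> d s d = fps_X * Abs_fps (\<lambda>n. anchor_sum \<mu> d n s)"
proof (rule fps_ext)
  fix n
  show "fps_nth (words_above_series \<mu> d s d) n =
      fps_nth (fps_X * Abs_fps (\<lambda>n. anchor_sum \<mu> d n s)) n"
  proof (cases n)
    case 0
    have "words_above \<mu> d d 0 = {}" by (auto simp: words_above_def)
    with 0 show ?thesis by (simp add: words_above_series_def)
  next
    case (Suc k)
    have "words_above \<mu> d d (Suc k) = (#) \<infinity> ` {w. anchor_word \<mu> d k w}" (is "?L = ?R")
    proof (intro equalityI subsetI)
      fix w assume "w \<in> ?L"
      then have w: "anchor_word \<mu> d (Suc k) w" "w \<noteq> []" "enat d < hd w"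
        by (auto simp: words_above_def)
      then have "hd w = \<infinity>" by (auto elim!: anchor_word_hd_cases)
      then obtain v where "w = \<infinity> # v" using w(2) by (cases w) auto
      then show "w \<in> ?R" using w(1) assms by auto
    qed (use assms in \<open>auto simp: words_above_def\<close>)
    then show ?thesis
      by (simp add: Suc words_above_series_def anchor_sum_eq_sum_word_weight sum.reindex
          letter_weight_def)
  qed
qed

text \<open>A first letter above \<open>m\<close> is either above \<open>Suc m\<close> or equal to
  it; the image collects the second case. Its \<open>if\<close> has the shape of the coefficients of
  a product with \<open>fps_X ^ l\<close>.\<close>

lemma words_above_step:
  assumes "integer_partition \<mu>" "length \<mu> = l + 1" "l \<ge> 1" "\<mu> ! l = 1" "\<mu> ! (l - 1) \<ge> d"
    and m: "Suc m \<le> d"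
  shows "words_above \<mu> d m n = words_above \<mu> d (Suc m) n \<union>
    (\<lambda>w. enat (Suc m) # replicate (l - 1) \<infinity> @ w) `
      (if l \<le> n then words_above \<mu> d (Suc m) (n - l) else {})"
    (is "_ = _ \<union> ?f ` ?R")
proof -
  have ne: "\<mu> \<noteq> []" using assms(2) by auto
  have key: "anchor_word \<mu> d n (enat (Suc m) # v) \<longleftrightarrow> enat (Suc m) # v \<in> ?f ` ?R" for v
  proof
    assume "anchor_word \<mu> d n (enat (Suc m) # v)"
    then obtain k where k: "n = Suc k" "anchor_word \<mu> d (Suc k) (enat (Suc m) # v)"
      by (cases n) auto
    then have v: "anchor_word \<mu> d k v" "l \<le> k"
      and ge: "\<And>i. i < l \<Longrightarrow> enat (Suc m) + enat (\<mu> ! Suc i) \<le> v ! i"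
      using anchor_word_Cons_iff[OF assms(2), of d k "enat (Suc m)" v] by auto
    have len: "length v = k" using v(1) by (rule anchor_word_length)
    have inf: "v ! i = \<infinity>" if "i < l - 1" for i
    proof -
      \<comment> \<open>The parts decrease weakly, so the bound \<open>d\<close> at index
        \<open>l - 1\<close> holds at \<open>Suc i\<close> too. It pushes the letter
        \<open>v ! i\<close> above \<open>d\<close>, where only \<infinity> is left.\<close>
      have "\<mu> ! (l - 1) \<le> \<mu> ! Suc i"
        using assms(1,2) that
        by (cases "Suc i = l - 1") (auto simp: integer_partition_def sorted_wrt_iff_nth_less)
      then have "enat d < enat (Suc m) + enat (\<mu> ! Suc i)" using assms(5) by simp
      also have "\<dots> \<le> v ! i" using ge that by simp
      finally have "enat d < v ! i" .
      moreover have "v ! i \<in> set v" using that v(2) len by simp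
      then have "v ! i \<in> enat ` {1..d} \<union> {\<infinity>}" using v(1) by (auto simp: anchor_word_def Let_def)
      ultimately show ?thesis by auto
    qed
    define u where "u = drop (l - 1) v"
    have take: "take (l - 1) v = replicate (l - 1) \<infinity>"
      using inf v(2) len by (intro nth_equalityI) auto
    have vu: "v = replicate (l - 1) \<infinity> @ u" by (metis take append_take_drop_id u_def)
    \<comment> \<open>The length \<open>k = n - 1\<close> of \<open>v\<close> is split to match
      \<open>replicate (l - 1) \<infinity> @ u\<close>.\<close>
    have "anchor_word \<mu> d ((l - 1) + (n - l)) v" using v k(1) assms(3) by simp
    then have "anchor_word \<mu> d (n - l) u" using ne by (simp add: vu)
    moreover have "u \<noteq> []" using v(2) len assms(3) by (simp add: u_def)
    moreover have "hd u = v ! (l - 1)" using v(2) len assms(3) by (simp add: u_def hd_drop_conv_nth)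
    \<comment> \<open>The head of \<open>u\<close> is at distance \<open>l\<close> from the first
      letter, where the part is 1: the condition is just strict increase.\<close>
    then have "enat (Suc m) + 1 \<le> hd u"
      using ge[of "l - 1"] assms(3,4) by (simp add: one_enat_def)
    then have "enat (Suc m) < hd u" by (cases "hd u") (auto simp: one_enat_def)
    ultimately show "enat (Suc m) # v \<in> ?f ` ?R"
      using v(2) k(1) by (auto simp: words_above_def vu)
  next
    assume "enat (Suc m) # v \<in> ?f ` ?R"
    then obtain u where u: "v = replicate (l - 1) \<infinity> @ u" "l \<le> n" "anchor_word \<mu> d (n - l) u"
      "u \<noteq> []" "enat (Suc m) < hd u"
      by (auto simp: words_above_def split: if_splits)
    have "length u = n - l" using u(3) by (rule anchor_word_length)
    \<comment> \<open>As \<open>u\<close> is nonempty, there is a letter beyond the removed block,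
      which yields the \<open>l \<le> k\<close> demanded of a finite first letter.\<close>
    then have "l < n" using u(4) by (cases "l < n") auto
    then obtain k where k: "n = Suc k" "l \<le> k" by (cases n) auto
    have "k = (l - 1) + (n - l)" using k assms(3) by simp
    then have "anchor_word \<mu> d k v"
      using u(1,3) anchor_word_replicate_infinity_append_iff[OF ne] by metis
    moreover have "enat (Suc m) + enat (\<mu> ! Suc i) \<le> v ! i" if "i < l" for i
    proof (cases "i < l - 1")
      case True
      then show ?thesis by (simp add: u(1) nth_append)
    next
      case False
      then have i: "i = l - 1" using that by simp
      have "v ! i = hd u" using u(4) by (simp add: u(1) i nth_append hd_conv_nth)
      moreover have "\<mu> ! Suc i = 1" using i assms(3,4) by simp
      ultimately show ?thesis using u(5) by (cases "hd u") auto
    qed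
    ultimately show "anchor_word \<mu> d n (enat (Suc m) # v)"
      using k m anchor_word_Cons_iff[OF assms(2), of d k "enat (Suc m)" v] by auto
  qed
  have "w \<in> words_above \<mu> d m n \<longleftrightarrow> w \<in> words_above \<mu> d (Suc m) n \<union> ?f ` ?R" for w
  \<comment> \<open>For the head \<open>Suc m\<close> this is \<open>key\<close>; for any other head
    the bounds \<open>m\<close> and \<open>Suc m\<close> select the same words.\<close>
  proof (cases "w \<noteq> [] \<and> hd w = enat (Suc m)")
    case True
    then obtain v where "w = enat (Suc m) # v" by (cases w) auto
    then show ?thesis using key[of v] by (simp add: words_above_def)
  next
    case False
    have "enat m < a \<longleftrightarrow> enat (Suc m) < a \<or> a = enat (Suc m)" for a
      by (cases a) auto
    with False have "w \<in> words_above \<mu> d m n \<longleftrightarrow> w \<in> words_above \<mu> d (Suc m) n"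
      unfolding words_above_def by blast
    moreover have "w \<notin> ?f ` ?R" using False by fastforce
    ultimately show ?thesis by blast
  qed
  then show ?thesis by blast
qed

text \<open>The removed block has length \<open>l\<close> and weight \<open>s (Suc m)\<close>, and
  the union in \<open>words_above_step\<close> is disjoint because the first letters differ.\<close>

lemma words_above_series_step:
  assumes "integer_partition \<mu>" "length \<mu> = l + 1" "l \<ge> 1" "\<mu> ! l = 1" "\<mu> ! (l - 1) \<ge> d"
    and "Suc m \<le> d"
  shows "words_above_series \<mu> d s m =
    (1 + fps_const (s (Suc m)) * fps_X ^ l) * words_above_series \<mu> d s (Suc m)"
proof (rule fps_ext)
  fix n
  let ?f = "\<lambda>w. enat (Suc m) # replicate (l - 1) \<infinity> @ w"
  let ?R = "if l \<le> n then words_above \<mu> d (Suc m) (n - l) else {}"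
  have "(\<Sum>w\<in>words_above \<mu> d m n. word_weight s w) =
      (\<Sum>w\<in>words_above \<mu> d (Suc m) n. word_weight s w) + (\<Sum>w\<in>?f ` ?R. word_weight s w)"
    unfolding words_above_step[OF assms]
    by (rule sum.union_disjoint) (simp_all add: finite_words_above, auto simp: words_above_def)
  also have "(\<Sum>w\<in>?f ` ?R. word_weight s w) = (\<Sum>w\<in>?R. s (Suc m) * word_weight s w)"
    by (subst sum.reindex) (auto simp: inj_on_def letter_weight_def)
  finally show "fps_nth (words_above_series \<mu> d s m) n =
      fps_nth ((1 + fps_const (s (Suc m)) * fps_X ^ l) * words_above_series \<mu> d s (Suc m)) n"
    by (simp add: words_above_series_def distrib_right mult.assoc fps_X_power_mult_nth
        sum_distrib_left)
qed

section \<open>Solving for the generating function\<close>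

text \<open>Applying the step \<open>d\<close> times leads from threshold 0 to threshold
  \<open>d\<close>, where the full series reappears with a factor \<open>fps_X\<close>; this gives a
  linear equation for it.\<close>

lemma anchor_series_recip:
  assumes "integer_partition \<mu>" "length \<mu> = l + 1" "l \<ge> 1" "\<mu> ! l = 1" "\<mu> ! (l - 1) \<ge> d"
  shows "Abs_fps (\<lambda>n. anchor_sum \<mu> d n s) =
    fps_recip (1 - fps_X * (\<Prod>r=1..d. 1 + fps_const (s r) * fps_X ^ l))"
    (is "?F = fps_recip (1 - fps_X * ?P)")
proof -
  have "words_above_series \<mu> d s 0 =
      (\<Prod>r=1..m. 1 + fps_const (s r) * fps_X ^ l) * words_above_series \<mu> d s m" if "m \<le> d" for m
    using that
  proof (induction m)
    case (Suc m)
    then show ?case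
      using words_above_series_step[OF assms, of m s] by (simp add: mult.assoc)
  qed simp
  from this[of d] have "words_above_series \<mu> d s 0 = ?P * (fps_X * ?F)"
    using words_above_series_top[of \<mu> d s] assms(2) by force
  then have "?F = 1 + ?P * (fps_X * ?F)"
    by (metis anchor_series_eq)
  then have "?F * (1 - fps_X * ?P) = 1"
    by (simp add: algebra_simps)
  then show ?thesis
    \<comment> \<open>The factor \<open>fps_X\<close> makes the constant term of the denominator 1,
      as uniqueness of the reciprocal requires.\<close>
    by (intro sym[OF iffD2[OF fps_recip_unique]]) simp_all
qed

theorem theorem5p4:
  fixes \<mu> :: "nat list" and l d :: nat
    and s :: "nat \<Rightarrow> 'a::comm_ring_1" and t :: 'a
  assumes "integer_partition \<mu>"
    and "length \<mu> = l + 1"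
    and "l \<ge> 1"
    and "1 \<le> d" and "d \<le> \<mu> ! 0"
    and "\<mu> ! l = 1"
    and "\<mu> ! (l - 1) \<ge> d"
  shows "Abs_fps (\<lambda>n. anchor_sum \<mu> d n s) =
           fps_recip (1 - fps_X * (\<Prod>r=1..d. 1 + fps_const (s r) * fps_X ^ l))
       \<and> Abs_fps (\<lambda>n. anchor_sum \<mu> d n (\<lambda>r. if r = 1 then t else 1)) =
           fps_recip (1 - fps_X * (1 + fps_X ^ l) ^ (d - 1) * (1 + fps_const t * fps_X ^ l))"
proof
  note recip = anchor_series_recip[OF assms(1-3,6,7)]
  show "Abs_fps (\<lambda>n. anchor_sum \<mu> d n s) =
      fps_recip (1 - fps_X * (\<Prod>r=1..d. 1 + fps_const (s r) * fps_X ^ l))"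
    by (rule recip)
  let ?t = "\<lambda>r::nat. if r = 1 then t else 1"
  \<comment> \<open>The factor at \<open>r = 1\<close> exists because \<open>1 \<le> d\<close>; the
    other \<open>d - 1\<close> factors are equal.\<close>
  have "(\<Prod>r=1..d. 1 + fps_const (?t r) * fps_X ^ l) =
      (1 + fps_const t * fps_X ^ l) * (\<Prod>r=2..d. 1 + fps_const (?t r) * fps_X ^ l)"
    using assms(4) by (subst prod.atLeast_Suc_atMost) (simp_all add: numeral_2_eq_2)
  also have "(\<Prod>r=2..d. 1 + fps_const (?t r) * fps_X ^ l) = (\<Prod>r=2..d. 1 + fps_X ^ l)"
    by (rule prod.cong) auto
  also have "\<dots> = (1 + fps_X ^ l) ^ (d - 1)"
    by simp
  finally have "fps_X * (\<Prod>r=1..d. 1 + fps_const (?t r) * fps_X ^ l) =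
      fps_X * (1 + fps_X ^ l) ^ (d - 1) * (1 + fps_const t * fps_X ^ l)"
    by (metis mult.commute mult.assoc)
  then show "Abs_fps (\<lambda>n. anchor_sum \<mu> d n ?t) =
      fps_recip (1 - fps_X * (1 + fps_X ^ l) ^ (d - 1) * (1 + fps_const t * fps_X ^ l))"
    using recip[of ?t] by (rule subst)
qed

end
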